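(* Let $P$ be the condensation measure on $\mathbb{R}$ satisfying $P=\frac13 P\circ S_1^{-1}+\frac13 P\circ S_2^{-1}+\frac13\nu$, with $S_1(x)=\frac15x$, $S_2(x)=\frac15x+\frac45$, where $\nu$ is the self-similar probability measure satisfying $\nu=\frac12\nu\circ T_1^{-1}+\frac12\nu\circ T_2^{-1}$ with $T_1(x)=\frac13x+\frac4{15}$, $T_2(x)=\frac13x+\frac25$. Let $\kappa$ be the unique number with $\left(\frac13\left(\frac15\right)^2\right)^{\frac{\kappa}{2+\kappa}}=\frac12$, i.e. $\kappa=\frac{2\log2}{\log75-\log2}$. Then $D(P)=\max\{\kappa,D(\nu)\}$.
   Context: For a Borel probability measure $\mu$ on $\mathbb{R}$ with compact support, $V_n(\mu)=\inf\{\int\min_{a\in\alpha}(x-a)^2\,d\mu(x):\alpha\subset\mathbb{R},\ 1\le\mathrm{card}(\alpha)\le n\}$ is the $n$th quantization error, and the quantization dimension is $D(\mu)=\lim_{n\to\infty}\frac{2\log n}{-\log V_n(\mu)}$ if the limit exists. Here $D(\nu)=\frac{\log2}{\log3}$. The measures $\nu$ and $P$ are the unique compactly supported Borel probability measures satisfying the displayed identities. *)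

theory Defs
  imports "HOL-Probability.Probability"
begin

definition measure_support :: "'a::topological_space measure \<Rightarrow> 'a set" where
  "measure_support \<mu> = {x. \<forall>U. open U \<longrightarrow> x \<in> U \<longrightarrow> emeasure \<mu> U > 0}"

definition compactly_supported_distribution :: "real measure \<Rightarrow> bool" where
  "compactly_supported_distribution \<mu> \<longleftrightarrow>
     real_distribution \<mu> \<and> compact (measure_support \<mu>)"

(* Intended for compactly supported distributions: there the integrand is integrable, so the
   Bochner integral is the usual one.  The condition 1 <= card A makes A finite and nonempty.
   The infimum is over the empty set, hence meaningless, only for n = 0. *)
definition quantization_error :: "nat \<Rightarrow> real measure \<Rightarrow> real" where
  "quantization_error n \<mu> =
     Inf {(\<integral>x. Min ((\<lambda>a. (x - a)\<^sup>2) ` A) \<partial>\<mu>) | A. 1 \<le> card A \<and> card A \<le> n}"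

definition quantization_ratio :: "real measure \<Rightarrow> nat \<Rightarrow> real" where
  "quantization_ratio \<mu> n = 2 * ln (real n) / (- ln (quantization_error n \<mu>))"

definition quantization_dim_exists :: "real measure \<Rightarrow> bool" where
  "quantization_dim_exists \<mu> \<longleftrightarrow> convergent (quantization_ratio \<mu>)"

(* Only meaningful when quantization_dim_exists holds. *)
definition quantization_dim :: "real measure \<Rightarrow> real" where
  "quantization_dim \<mu> = lim (quantization_ratio \<mu>)"

definition S1 :: "real \<Rightarrow> real" where "S1 x = 1/5 * x"
definition S2 :: "real \<Rightarrow> real" where "S2 x = 1/5 * x + 4/5"

definition T1 :: "real \<Rightarrow> real" where "T1 x = 1/3 * x + 4/15"
definition T2 :: "real \<Rightarrow> real" where "T2 x = 1/3 * x + 2/5"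

end

theory Submission
  imports Defs "HOL-Real_Asymp.Real_Asymp"
begin

text \<open>
  Both dimensions equal \<open>ln 2 / ln 3\<close>, which exceeds \<open>\<kappa>\<close> because \<open>9 < 75/2\<close>.
  An interval of length \<open>3^-k/5\<close> has \<open>\<nu>\<close>-measure at most \<open>2^-k\<close>, so \<open>2^k\<close> points leave
  half of the mass of \<open>\<nu>\<close> at distance of order \<open>3^-k\<close>; hence \<open>V(2^k) \<ge> c 9^-k\<close> for \<open>\<nu>\<close> and,
  as \<open>P \<ge> \<nu>/3\<close>, also for \<open>P\<close>. Conversely \<open>V(2n) \<le> V(n)/9\<close> for \<open>\<nu>\<close>, and combining the images
  under \<open>S1\<close>, \<open>S2\<close> of a quantizer of \<open>P\<close> with \<open>2^k\<close> points adapted to \<open>\<nu>\<close> yields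
  \<open>V((k + 1) 2^k) \<le> 9^-k\<close> for \<open>P\<close>, since \<open>2/75 + 1/27 \<le> 1/9\<close>. The factor \<open>k + 1\<close> is
  invisible on the logarithmic scale.
\<close>

section \<open>Mixtures of finite measures\<close>

text \<open>Both defining identities speak of real-valued measures of Borel sets. The standard
  induction over indicators, multiples, sums and monotone limits carries them over to nonnegative
  integrals, without integrability conditions.\<close>

lemma nn_integral_finite_mixture:
  fixes c :: "'i \<Rightarrow> real" and f :: "'a \<Rightarrow> ennreal"
  assumes I: "finite I" and M: "finite_measure M"
    and N: "\<And>i. i \<in> I \<Longrightarrow> finite_measure (N i)"
    and sets: "\<And>i. i \<in> I \<Longrightarrow> sets (N i) = sets M"
    and c: "\<And>i. i \<in> I \<Longrightarrow> 0 \<le> c i"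
    and mix: "\<And>A. A \<in> sets M \<Longrightarrow> measure M A = (\<Sum>i\<in>I. c i * measure (N i) A)"
    and f: "f \<in> borel_measurable M"
  shows "(\<integral>\<^sup>+x. f x \<partial>M) = (\<Sum>i\<in>I. ennreal (c i) * (\<integral>\<^sup>+x. f x \<partial>N i))"
  using f
proof (induction rule: borel_measurable_induct)
  case (cong f g)
  have "(\<integral>\<^sup>+x. f x \<partial>M) = (\<integral>\<^sup>+x. g x \<partial>M)"
    by (intro nn_integral_cong cong)
  moreover have "(\<integral>\<^sup>+x. f x \<partial>N i) = (\<integral>\<^sup>+x. g x \<partial>N i)" if "i \<in> I" for i
    using sets_eq_imp_space_eq[OF sets[OF that]] by (intro nn_integral_cong) (simp add: cong)
  ultimately show ?case
    using cong.IH by simp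
next
  case (set A)
  have "emeasure M A = ennreal (\<Sum>i\<in>I. c i * measure (N i) A)"
    using mix[OF set] by (simp add: finite_measure.emeasure_eq_measure[OF M])
  also have "\<dots> = (\<Sum>i\<in>I. ennreal (c i) * emeasure (N i) A)"
    by (subst sum_ennreal[symmetric])
      (auto intro!: sum.cong mult_nonneg_nonneg c
        simp: ennreal_mult'' finite_measure.emeasure_eq_measure[OF N])
  finally show ?case
    using set by (simp add: sets cong: sum.cong)
next
  case (mult u k)
  have [measurable]: "u \<in> borel_measurable (N i)" if "i \<in> I" for i
    using mult.hyps(2) sets[OF that] by (simp cong: measurable_cong_sets)
  have "(\<integral>\<^sup>+x. k * u x \<partial>M) = k * (\<Sum>i\<in>I. ennreal (c i) * (\<integral>\<^sup>+x. u x \<partial>N i))"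
    using mult by (simp add: nn_integral_cmult)
  also have "\<dots> = (\<Sum>i\<in>I. ennreal (c i) * (\<integral>\<^sup>+x. k * u x \<partial>N i))"
    unfolding sum_distrib_left by (intro sum.cong) (auto simp: nn_integral_cmult mult.left_commute)
  finally show ?case .
next
  case (add u v)
  have [measurable]: "u \<in> borel_measurable (N i)" "v \<in> borel_measurable (N i)" if "i \<in> I" for i
    using add.hyps sets[OF that] by (simp_all cong: measurable_cong_sets)
  show ?case
    using add by (simp add: nn_integral_add distrib_left sum.distrib cong: sum.cong)
next
  case (seq U)
  have [measurable]: "U j \<in> borel_measurable (N i)" if "i \<in> I" for i j
    using seq.hyps(1) sets[OF that] by (simp cong: measurable_cong_sets)
  have mono: "incseq (\<lambda>j. \<integral>\<^sup>+x. U j x \<partial>K)" for K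
    using \<open>incseq U\<close> by (auto simp: incseq_def le_fun_def intro!: nn_integral_mono)
  have "(\<integral>\<^sup>+x. (SUP j. U j) x \<partial>M) = (SUP j. \<Sum>i\<in>I. ennreal (c i) * (\<integral>\<^sup>+x. U j x \<partial>N i))"
    using seq by (simp add: nn_integral_monotone_convergence_SUP image_comp)
  also have "\<dots> = (\<Sum>i\<in>I. SUP j. ennreal (c i) * (\<integral>\<^sup>+x. U j x \<partial>N i))"
    by (intro ennreal_SUP_sum) (use mono in \<open>auto simp: incseq_def intro!: mult_left_mono\<close>)
  also have "\<dots> = (\<Sum>i\<in>I. ennreal (c i) * (\<integral>\<^sup>+x. (SUP j. U j) x \<partial>N i))"
    using seq by (intro sum.cong)
      (auto simp: nn_integral_monotone_convergence_SUP image_comp SUP_mult_left_ennreal)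
  finally show ?case .
qed

section \<open>Concentration on a bounded interval\<close>

text \<open>Iterating \<open>tail\<close> pushes a tail out to infinity by powers of
  \<open>L\<close> without losing mass, while tails at infinity have vanishing mass; so all tails
  beyond \<open>r\<close> are null. For a measure invariant under contractions, \<open>L\<close> is
  the reciprocal of the contraction ratio.\<close>

lemma (in real_distribution) AE_le_of_tail_expansion:
  assumes L: "1 < L"
    and tail: "\<And>t. 0 < t \<Longrightarrow> prob {x. r + t < \<bar>x - c\<bar>} \<le> prob {x. r + L * t < \<bar>x - c\<bar>}"
  shows "AE x in M. \<bar>x - c\<bar> \<le> r"
proof -
  have null: "prob {x. r + t < \<bar>x - c\<bar>} = 0" if "0 < t" for t
  proof -
    define B where "B k = {x. r + L ^ k * t < \<bar>x - c\<bar>}" for k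
    have le: "prob (B 0) \<le> prob (B k)" for k
    proof (induction k)
      case (Suc k)
      then show ?case
        using tail[of "L ^ k * t"] that L unfolding B_def by (simp add: mult.assoc)
    qed simp
    have "decseq B"
    proof (rule decseq_SucI)
      fix k
      have "L ^ k * t \<le> L ^ Suc k * t"
        using L that by (intro mult_right_mono power_increasing) auto
      then show "B (Suc k) \<subseteq> B k"
        unfolding B_def by auto
    qed
    moreover have "(\<Inter>k. B k) = {}"
    proof -
      have "\<exists>k. \<bar>x - c\<bar> \<le> r + L ^ k * t" for x
      proof -
        obtain k where "(\<bar>x - c\<bar> - r) / t < L ^ k"
          using real_arch_pow[OF L] by blast
        then show ?thesis
          using that by (intro exI[of _ k]) (simp add: divide_less_eq)
      qed
      then have "x \<notin> (\<Inter>k. B k)" for x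
        unfolding B_def by (metis INT_E UNIV_I mem_Collect_eq not_le)
      then show ?thesis
        by blast
    qed
    moreover have "range B \<subseteq> events"
      unfolding B_def by auto
    ultimately have "(\<lambda>k. prob (B k)) \<longlonglongrightarrow> 0"
      using finite_Lim_measure_decseq[of B] by simp
    then have "prob (B 0) \<le> 0"
      using le by (intro LIMSEQ_le_const) auto
    then show ?thesis
      unfolding B_def by (simp add: measure_le_0_iff)
  qed
  have "AE x in M. \<forall>n. \<bar>x - c\<bar> \<le> r + inverse (real (Suc n))"
    unfolding AE_all_countable
  proof
    fix n
    show "AE x in M. \<bar>x - c\<bar> \<le> r + inverse (real (Suc n))"
      using null[of "inverse (real (Suc n))"]
      by (intro AE_I'[of "{x. r + inverse (real (Suc n)) < \<bar>x - c\<bar>}"])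
        (auto simp: null_sets_def emeasure_eq_measure)
  qed
  then show ?thesis
  proof eventually_elim
    case (elim x)
    show ?case
    proof (rule ccontr)
      assume "\<not> \<bar>x - c\<bar> \<le> r"
      then obtain n where "inverse (real (Suc n)) < \<bar>x - c\<bar> - r"
        using reals_Archimedean[of "\<bar>x - c\<bar> - r"] by auto
      then show False
        using elim[rule_format, of n] by auto
    qed
  qed
qed

lemma (in real_distribution) measure_distr_vimage:
  assumes "T \<in> borel_measurable borel" "A \<in> sets borel"
  shows "measure (distr M borel T) A = prob (T -` A)"
  using assms by (subst measure_distr) (auto cong: measurable_cong_sets)

section \<open>Distortion and quantization error\<close>

definition sq_dist :: "real set \<Rightarrow> real \<Rightarrow> real" where
  "sq_dist A x = Min ((\<lambda>a. (x - a)\<^sup>2) ` A)"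

lemma sq_dist_le:
  assumes "finite A" "a \<in> A"
  shows "sq_dist A x \<le> (x - a)\<^sup>2"
  using assms unfolding sq_dist_def by (intro Min_le) auto

lemma sq_dist_attained:
  assumes "finite A" "A \<noteq> {}"
  obtains a where "a \<in> A" "sq_dist A x = (x - a)\<^sup>2"
proof -
  have "sq_dist A x \<in> (\<lambda>a. (x - a)\<^sup>2) ` A"
    unfolding sq_dist_def using assms by (intro Min_in) auto
  then show ?thesis
    using that by blast
qed

lemma sq_dist_nonneg:
  assumes "finite A" "A \<noteq> {}"
  shows "0 \<le> sq_dist A x"
  by (rule sq_dist_attained[OF assms, of x]) auto

lemma borel_measurable_sq_dist [measurable]:
  assumes "finite A"
  shows "sq_dist A \<in> borel_measurable borel"
  unfolding sq_dist_def using assms by measurable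

text \<open>Values in \<open>ennreal\<close> let the mixture and scaling rules hold unconditionally;
  \<open>quantization_error_le\<close> passes back to the Bochner integral.\<close>

definition distortion :: "real measure \<Rightarrow> real set \<Rightarrow> ennreal" where
  "distortion \<mu> A = (\<integral>\<^sup>+x. ennreal (sq_dist A x) \<partial>\<mu>)"

lemma distortion_antimono:
  assumes "finite B" "A \<subseteq> B" "A \<noteq> {}"
  shows "distortion \<mu> B \<le> distortion \<mu> A"
  unfolding distortion_def sq_dist_def using assms
  by (intro nn_integral_mono ennreal_leI Min_antimono image_mono) auto

text \<open>If \<open>a\<close> is nearest to \<open>x\<close> in \<open>A\<close>, then
  \<open>T a\<close> is a candidate for \<open>T x\<close>, and \<open>T\<close> multiplies squared
  distances by \<open>s\<^sup>2\<close>. \<open>B\<close> may exceed the image of \<open>A\<close>,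
  so one set can serve several maps at once.\<close>

lemma distortion_distr_affine:
  assumes \<mu>: "sets \<mu> = sets borel" and B: "finite B" and A: "finite A" "A \<noteq> {}" "T ` A \<subseteq> B"
    and T: "\<And>x. T x = s * x + d"
  shows "distortion (distr \<mu> borel T) B \<le> ennreal (s\<^sup>2) * distortion \<mu> A"
proof -
  have [measurable]: "T \<in> borel_measurable borel"
    unfolding T[abs_def] by measurable
  have [measurable]: "sq_dist B \<in> borel_measurable borel" "sq_dist A \<in> borel_measurable borel"
    using B A by auto
  have "distortion (distr \<mu> borel T) B = (\<integral>\<^sup>+x. ennreal (sq_dist B (T x)) \<partial>\<mu>)"
    unfolding distortion_def using \<mu> by (subst nn_integral_distr) (auto cong: measurable_cong_sets)
  also have "\<dots> \<le> (\<integral>\<^sup>+x. ennreal (s\<^sup>2) * ennreal (sq_dist A x) \<partial>\<mu>)"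
  proof (rule nn_integral_mono)
    fix x
    obtain a where a: "a \<in> A" "sq_dist A x = (x - a)\<^sup>2"
      by (rule sq_dist_attained[OF A(1,2)])
    have "sq_dist B (T x) \<le> (T x - T a)\<^sup>2"
      using a A B by (intro sq_dist_le) auto
    also have "\<dots> = s\<^sup>2 * (x - a)\<^sup>2"
      by (simp add: T power_mult_distrib[symmetric] algebra_simps)
    finally show "ennreal (sq_dist B (T x)) \<le> ennreal (s\<^sup>2) * ennreal (sq_dist A x)"
      using a by (simp add: ennreal_mult[symmetric])
  qed
  also have "\<dots> = ennreal (s\<^sup>2) * distortion \<mu> A"
    unfolding distortion_def using \<mu>
    by (intro nn_integral_cmult) (auto cong: measurable_cong_sets)
  finally show ?thesis .
qed

context real_distribution
begin

lemma quantization_error_eq: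
  "quantization_error n M = Inf {\<integral>x. sq_dist A x \<partial>M |A. 1 \<le> card A \<and> card A \<le> n}"
  unfolding quantization_error_def sq_dist_def ..

lemma quantization_error_bdd_below:
  "bdd_below {\<integral>x. sq_dist A x \<partial>M |A. 1 \<le> card A \<and> card A \<le> n}"
proof (rule bdd_belowI[of _ 0], clarify)
  fix A :: "real set" assume "1 \<le> card A"
  then have "finite A" "A \<noteq> {}"
    using card.infinite by fastforce+
  then show "0 \<le> (\<integral>x. sq_dist A x \<partial>M)"
    by (intro integral_nonneg_AE) (simp add: sq_dist_nonneg)
qed

lemma quantization_error_nonempty:
  assumes "1 \<le> n"
  shows "{\<integral>x. sq_dist A x \<partial>M |A. 1 \<le> card A \<and> card A \<le> n} \<noteq> {}"
  using assms by (auto intro!: exI[of _ "{0}"])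

lemma quantization_error_antimono:
  assumes "1 \<le> m" "m \<le> n"
  shows "quantization_error n M \<le> quantization_error m M"
  unfolding quantization_error_eq
  using quantization_error_nonempty[OF assms(1)] quantization_error_bdd_below[of n] assms
  by (intro cInf_superset_mono) (auto intro: order_trans)

lemma quantization_error_le:
  assumes A: "finite A" "A \<noteq> {}" "card A \<le> n" and e: "distortion M A \<le> ennreal e" "0 \<le> e"
  shows "quantization_error n M \<le> e"
proof -
  have "quantization_error n M \<le> (\<integral>x. sq_dist A x \<partial>M)"
    unfolding quantization_error_eq using A
    by (intro cInf_lower quantization_error_bdd_below) (auto simp: Suc_le_eq card_gt_0_iff)
  \<comment> \<open>This equation survives non-integrability: both sides are then 0 by
    convention.\<close>
  also have "\<dots> = enn2real (distortion M A)"
    unfolding distortion_def using A by (intro integral_eq_nn_integral) (auto simp: sq_dist_nonneg)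
  also have "\<dots> \<le> e"
    using e by (intro enn2real_leI)
  finally show ?thesis .
qed

text \<open>Lower bounds depend on this: the Bochner integral of a non-integrable function would be
  0, and Markov's inequality would fail.\<close>

lemma integrable_sq_dist:
  assumes A: "finite A" "A \<noteq> {}" and bnd: "AE x in M. \<bar>x - c\<bar> \<le> r"
  shows "integrable M (sq_dist A)"
proof -
  obtain a where a: "a \<in> A"
    using A by auto
  have "AE x in M. norm (sq_dist A x) \<le> (r + \<bar>c - a\<bar>)\<^sup>2"
    using bnd
  proof eventually_elim
    case (elim x)
    have "sq_dist A x \<le> (x - a)\<^sup>2"
      by (rule sq_dist_le[OF A(1) a])
    also have "\<dots> \<le> (r + \<bar>c - a\<bar>)\<^sup>2"
      using elim by (intro abs_le_square_iff[THEN iffD1]) auto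
    finally show ?case
      using A by (simp add: sq_dist_nonneg)
  qed
  then show ?thesis
    using A by (intro integrable_const_bound) auto
qed

text \<open>Markov's inequality at level \<delta>, applied to each competing set
  \<open>A\<close>.\<close>

lemma quantization_error_ge:
  assumes bnd: "AE x in M. \<bar>x - c\<bar> \<le> r" and \<delta>: "0 < \<delta>" and n: "1 \<le> n"
    and far: "\<And>A. finite A \<Longrightarrow> A \<noteq> {} \<Longrightarrow> card A \<le> n \<Longrightarrow> q \<le> prob {x. \<delta> \<le> sq_dist A x}"
  shows "q * \<delta> \<le> quantization_error n M"
  unfolding quantization_error_eq
proof (intro cInf_greatest quantization_error_nonempty[OF n], clarify)
  fix A :: "real set" assume "1 \<le> card A" "card A \<le> n"
  then have A: "finite A" "A \<noteq> {}"
    using card.infinite by fastforce+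
  have "q \<le> prob {x \<in> space M. \<delta> \<le> sq_dist A x}"
    using far[OF A] \<open>card A \<le> n\<close> by simp
  also have "\<dots> \<le> (\<integral>x. sq_dist A x \<partial>M) / \<delta>"
    using A \<delta> integrable_sq_dist[OF A bnd]
    by (intro integral_Markov_inequality_measure[where A = "{}"]) (auto simp: sq_dist_nonneg)
  finally show "q * \<delta> \<le> (\<integral>x. sq_dist A x \<partial>M)"
    using \<delta> by (simp add: le_divide_eq)
qed

end

section \<open>The growth rate\<close>

text \<open>By monotonicity the bounds along the two subsequences extend to all \<open>n\<close>.
  They confine \<open>- ln (V n)\<close> between two functions asymptotic to
  \<open>log 2 n * ln 9\<close>, so the ratio tends to 2 ln 2 / ln 9.\<close>

lemma ratio_tendsto_log2_log3:
  fixes V :: "nat \<Rightarrow> real"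
  assumes anti: "\<And>m n. 1 \<le> m \<Longrightarrow> m \<le> n \<Longrightarrow> V n \<le> V m"
    and up: "\<And>k. V ((k + 1) * 2 ^ k) \<le> (1/9) ^ k"
    and low: "\<And>k. c * (1/9) ^ k \<le> V (2 ^ k)" and c: "0 < c"
  shows "(\<lambda>n. 2 * ln (real n) / (- ln (V n))) \<longlonglongrightarrow> ln 2 / ln 3"
proof -
  \<comment> \<open>\<open>g\<close> comes from \<open>low\<close> at the first power of 2 above
    \<open>n\<close>, and \<open>f\<close> from \<open>up\<close> at the largest power of 2 below n
    / (log 2 n + 1). The shifts by 1 absorb rounding, and the form in \<open>ln\<close> alone suits
    \<open>real_asymp\<close>.\<close>
  define f g :: "real \<Rightarrow> real"
    where "f x = (ln (x / (ln x / ln 2 + 1)) / ln 2 - 1) * ln 9"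
      and "g x = (ln x / ln 2 + 1) * ln 9 - ln c" for x
  have bounds: "0 < V n \<and> - ln (V n) \<le> g (real n) \<and> f (real n) \<le> - ln (V n)"
    if n: "1 \<le> n" for n
  proof -
    define k where "k = nat \<lfloor>log 2 (real n)\<rfloor>"
    have log0: "0 \<le> log 2 (real n)"
      using n by simp
    have k: "real k \<le> log 2 (real n)" "log 2 (real n) < real k + 1"
      unfolding k_def using log0 by linarith+
    have "real n \<le> 2 powr (real k + 1)"
      using k n by (subst log_le_iff[symmetric]) auto
    also have "2 powr (real k + 1) = real (2 ^ Suc k)"
      by (simp add: powr_add powr_realpow)
    finally have "n \<le> 2 ^ Suc k"
      by (simp only: of_nat_le_iff)
    then have lo: "c * (1/9) ^ Suc k \<le> V n"
      using low[of "Suc k"] anti[OF n] by (meson order_trans)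
    have Vpos: "0 < V n"
      by (rule less_le_trans[OF _ lo]) (use c in simp)
    have "ln c - real (Suc k) * ln 9 = ln (c * (1/9) ^ Suc k)"
      using c by (simp add: ln_mult_pos ln_realpow ln_div algebra_simps del: power_Suc)
    also have "\<dots> \<le> ln (V n)"
      using lo c Vpos by (subst ln_le_cancel_iff) auto
    finally have "- ln (V n) \<le> real (Suc k) * ln 9 - ln c"
      by simp
    also have "\<dots> \<le> g (real n)"
      using k unfolding g_def log_def by (auto intro!: mult_right_mono)
    finally have g: "- ln (V n) \<le> g (real n)" .
    \<comment> \<open>With this \<open>y\<close>, (log 2 n + 1) y = n. Since j \<le> log 2 n and 2^j
      \<le> y, the number (j + 1) 2^j is at most n, so \<open>up\<close> applies at
      \<open>j\<close>.\<close>
    define y where "y = real n / (log 2 (real n) + 1)"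
    define j where "j = nat \<lfloor>log 2 y\<rfloor>"
    have ypos: "0 < y"
      unfolding y_def using log0 n by (intro divide_pos_pos) linarith+
    have f: "f (real n) = (log 2 y - 1) * ln 9"
      unfolding f_def y_def log_def ..
    have "f (real n) \<le> - ln (V n)"
    proof (cases "0 \<le> log 2 y")
      case True
      then have j: "real j \<le> log 2 y" "log 2 y < real j + 1"
        unfolding j_def by linarith+
      have "2 ^ j = 2 powr real j"
        by (simp add: powr_realpow)
      also have "\<dots> \<le> y"
        using j ypos by (simp add: le_log_iff)
      finally have jy: "2 ^ j \<le> y" .
      have "y \<le> real n / 1"
        unfolding y_def using log0 by (intro divide_left_mono) auto
      then have "log 2 y \<le> log 2 (real n)"
        using ypos n by simp
      then have "real ((j + 1) * 2 ^ j) \<le> (log 2 (real n) + 1) * y"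
        using j jy log0 by (simp only: of_nat_mult) (intro mult_mono, auto)
      also have "\<dots> = real n"
        unfolding y_def using log0 by (simp add: field_simps)
      finally have "(j + 1) * 2 ^ j \<le> n"
        by (simp only: of_nat_le_iff)
      then have "V n \<le> (1/9) ^ j"
        by (intro order_trans[OF anti up]) (auto simp: Suc_le_eq)
      then have "ln (V n) \<le> ln ((1/9) ^ j)"
        using Vpos by simp
      also have "\<dots> = - real j * ln 9"
        by (simp add: ln_realpow ln_div)
      finally have "real j * ln 9 \<le> - ln (V n)"
        by simp
      moreover have "(log 2 y - 1) * ln 9 \<le> real j * ln 9"
        using j by (intro mult_right_mono) auto
      ultimately show ?thesis
        unfolding f by linarith
    next
      \<comment> \<open>Here \<open>nat\<close> would truncate a negative floor, but then
        \<open>f (real n)\<close> is negative and V n \<le> V 1 \<le> 1 suffices.\<close>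
      case False
      have "V n \<le> 1"
        using up[of 0] anti[of 1 n] n by auto
      then have "0 \<le> - ln (V n)"
        using Vpos by simp
      moreover have "(log 2 y - 1) * ln 9 \<le> 0"
        using False by (intro mult_nonpos_nonneg) auto
      ultimately show ?thesis
        unfolding f by simp
    qed
    then show ?thesis
      using Vpos g by simp
  qed
  \<comment> \<open>Inverting the bounds on \<open>- ln (V n)\<close> requires positive
    denominators; \<open>f\<close> is the smallest of the three.\<close>
  have fpos: "\<forall>\<^sub>F n in sequentially. 0 < f (real n)"
    unfolding f_def by real_asymp
  have ln9: "ln 9 = 2 * ln (3::real)"
    using ln_realpow[of 3 2] by simp
  have "(\<lambda>n. 2 * ln (real n) / g (real n)) \<longlonglongrightarrow> 2 * (ln 2 * inverse (ln 9))"
    unfolding g_def by real_asymp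
  then have limg: "(\<lambda>n. 2 * ln (real n) / g (real n)) \<longlonglongrightarrow> ln 2 / ln 3"
    by (simp add: ln9 field_simps)
  have "(\<lambda>n. 2 * ln (real n) / f (real n)) \<longlonglongrightarrow> 2 * (ln 2 * inverse (ln 9))"
    unfolding f_def by real_asymp
  then have limf: "(\<lambda>n. 2 * ln (real n) / f (real n)) \<longlonglongrightarrow> ln 2 / ln 3"
    by (simp add: ln9 field_simps)
  show ?thesis
  proof (rule tendsto_sandwich[OF _ _ limg limf])
    show "\<forall>\<^sub>F n in sequentially. 2 * ln (real n) / g (real n) \<le> 2 * ln (real n) / - ln (V n)"
      using fpos eventually_ge_at_top[of 1]
    proof eventually_elim
      case (elim n)
      have "0 \<le> 2 * ln (real n)"
        using elim by simp
      moreover have "f (real n) \<le> - ln (V n)" "- ln (V n) \<le> g (real n)"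
        using bounds elim by auto
      ultimately show ?case
        using elim(1) by (intro divide_left_mono mult_pos_pos) linarith+
    qed
    show "\<forall>\<^sub>F n in sequentially. 2 * ln (real n) / - ln (V n) \<le> 2 * ln (real n) / f (real n)"
      using fpos eventually_ge_at_top[of 1]
    proof eventually_elim
      case (elim n)
      have "0 \<le> 2 * ln (real n)"
        using elim by simp
      moreover have "f (real n) \<le> - ln (V n)" "- ln (V n) \<le> g (real n)"
        using bounds elim by auto
      ultimately show ?case
        using elim(1) by (intro divide_left_mono mult_pos_pos) linarith+
    qed
  qed
qed

section \<open>The self-similar measure\<close>

locale self_similar_measure = real_distribution \<nu> for \<nu> :: "real measure" +
  assumes self_similar: "\<And>A. A \<in> sets borel \<Longrightarrow>
      measure \<nu> A = 1/2 * measure (distr \<nu> borel T1) A + 1/2 * measure (distr \<nu> borel T2) A"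
begin

lemma T_measurable [measurable]: "T1 \<in> borel_measurable borel" "T2 \<in> borel_measurable borel"
  unfolding T1_def[abs_def] T2_def[abs_def] by measurable

lemma prob_split:
  assumes "A \<in> sets borel"
  shows "prob A = 1/2 * prob (T1 -` A) + 1/2 * prob (T2 -` A)"
  using self_similar[OF assms] assms by (simp add: measure_distr_vimage)

text \<open>The interval is [2/5, 3/5], spanned by the fixed points of \<open>T1\<close> and
  \<open>T2\<close>. Both maps have ratio 1/3, so the preimage of a tail at distance
  \<open>t\<close> beyond it lies at distance at least \<open>3 * t\<close>.\<close>

lemma AE_hull: "AE x in \<nu>. \<bar>x - 1/2\<bar> \<le> 1/10"
proof (rule AE_le_of_tail_expansion[of 3])
  fix t :: real assume "0 < t"
  let ?A = "{x::real. 1/10 + t < \<bar>x - 1/2\<bar>}" and ?B = "{x::real. 1/10 + 3 * t < \<bar>x - 1/2\<bar>}"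
  have "prob (T1 -` ?A) \<le> prob ?B" "prob (T2 -` ?A) \<le> prob ?B"
    by (intro finite_measure_mono; auto simp: T1_def T2_def abs_if split: if_splits)+
  then show "prob ?A \<le> prob ?B"
    by (subst prob_split) auto
qed simp

lemma prob_outside_hull:
  assumes "\<And>x. x \<in> A \<Longrightarrow> 1/10 < \<bar>x - 1/2\<bar>"
  shows "prob A = 0"
proof -
  have "AE x in \<nu>. x \<notin> A"
    using AE_hull assms by (auto elim!: eventually_mono simp: not_less[symmetric])
  \<comment> \<open>A non-measurable \<open>A\<close> has \<open>prob A = 0\<close> by convention,
    which spares callers a measurability condition.\<close>
  then show ?thesis
    by (cases "A \<in> events") (auto simp: prob_eq_0 measure_notin_sets)
qed

text \<open>Preimages under \<open>T1\<close> and \<open>T2\<close> are again intervals, three times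
  as long, and only one of them can carry mass. Each level therefore contributes a factor
  1/2.\<close>

lemma prob_interval_le: "prob {a<..<a + 1/5 * (1/3) ^ k} \<le> (1/2) ^ k"
proof (induction k arbitrary: a)
  case (Suc k)
  let ?I = "{a<..<a + 1/5 * (1/3) ^ Suc k}"
  have vimage: "T1 -` ?I = {3 * a - 4/5<..<3 * a - 4/5 + 1/5 * (1/3) ^ k}"
      "T2 -` ?I = {3 * a - 6/5<..<3 * a - 6/5 + 1/5 * (1/3) ^ k}"
    by (auto simp: T1_def T2_def)
  have pw: "(1/3::real) ^ k \<le> 1"
    by (simp add: power_le_one)
  \<comment> \<open>The gap between \<open>T1 ` [2/5, 3/5]\<close> and \<open>T2 ` [2/5, 3/5]\<close> has length 1/15,
      so a shorter interval meets at most one of the two.\<close>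
  have "prob (T1 -` ?I) = 0 \<or> prob (T2 -` ?I) = 0"
  \<comment> \<open>7/15 = \<open>T1 (3/5)\<close> is the right end of the first piece. If a < 7/15,
    the interval ends before 8/15 = \<open>T2 (2/5)\<close>, where the second piece starts.\<close>
  proof (cases "7/15 \<le> a")
    case True
    then have "prob (T1 -` ?I) = 0"
      unfolding vimage by (intro prob_outside_hull) auto
    then show ?thesis ..
  next
    case False
    then have "prob (T2 -` ?I) = 0"
      unfolding vimage using pw by (intro prob_outside_hull) auto
    then show ?thesis ..
  qed
  moreover have "prob (T1 -` ?I) \<le> (1/2) ^ k" "prob (T2 -` ?I) \<le> (1/2) ^ k"
    unfolding vimage by (rule Suc.IH)+
  ultimately show ?case
    by (subst prob_split) auto
qed simp

text \<open>The points closer than \<open>r\<close> to \<open>A\<close> lie in at most 2^k intervals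
  of mass at most 2^-(k+1) each. Working one level beyond \<open>k\<close> is what leaves half of
  the mass.\<close>

lemma prob_far_ge:
  assumes A: "finite A" "A \<noteq> {}" "card A \<le> 2 ^ k"
  shows "1/2 \<le> prob {x. 1/900 * (1/9) ^ k \<le> sq_dist A x}"
proof -
  \<comment> \<open>\<open>r\<close> is half the interval length of \<open>prob_interval_le\<close>
    at level \<open>Suc k\<close>; below, the right end a + r is written to match that
    lemma.\<close>
  define r :: real where "r = 1/10 * (1/3) ^ Suc k"
  have r: "0 < r" "r\<^sup>2 = 1/900 * (1/9) ^ k"
    unfolding r_def by (simp_all add: power_mult_distrib power_one_over power2_eq_square flip: power_mult_distrib)
  have meas: "{x. sq_dist A x < r\<^sup>2} \<in> sets borel"
    using A by measurable
  have "prob {x. sq_dist A x < r\<^sup>2} \<le> prob (\<Union>a\<in>A. {a - r<..<a - r + 1/5 * (1/3) ^ Suc k})"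
  proof (rule finite_measure_mono)
    show "{x. sq_dist A x < r\<^sup>2} \<subseteq> (\<Union>a\<in>A. {a - r<..<a - r + 1/5 * (1/3) ^ Suc k})"
    proof
      fix x assume x: "x \<in> {x. sq_dist A x < r\<^sup>2}"
      obtain a where a: "a \<in> A" "sq_dist A x = (x - a)\<^sup>2"
        by (rule sq_dist_attained[OF A(1,2)])
      then have "\<bar>x - a\<bar>\<^sup>2 < r\<^sup>2"
        using x by simp
      then have "\<bar>x - a\<bar> < r"
        by (rule power2_less_imp_less) (use r(1) in simp)
      moreover have "1/5 * (1/3) ^ Suc k = 2 * r"
        unfolding r_def by simp
      ultimately show "x \<in> (\<Union>a\<in>A. {a - r<..<a - r + 1/5 * (1/3) ^ Suc k})"
        using a(1) by (intro UN_I[of a]) auto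
    qed
  qed (use A in auto)
  also have "\<dots> \<le> (\<Sum>a\<in>A. prob {a - r<..<a - r + 1/5 * (1/3) ^ Suc k})"
    using A by (intro finite_measure_subadditive_finite) auto
  also have "\<dots> \<le> (\<Sum>a\<in>A. (1/2) ^ Suc k)"
    by (intro sum_mono prob_interval_le)
  also have "\<dots> \<le> 2 ^ k * (1/2) ^ Suc k"
  proof -
    have "real (card A) \<le> 2 ^ k"
      using A(3) by (metis of_nat_le_iff of_nat_numeral of_nat_power)
    then show ?thesis
      by (simp add: mult_right_mono)
  qed
  also have "\<dots> = 1/2"
    by (simp add: power_one_over)
  finally have "prob {x. sq_dist A x < r\<^sup>2} \<le> 1/2" .
  moreover have "prob {x. r\<^sup>2 \<le> sq_dist A x} = 1 - prob {x. sq_dist A x < r\<^sup>2}"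
    using meas by (subst prob_compl[symmetric]) (auto intro!: arg_cong[where f = prob])
  ultimately show ?thesis
    using r by simp
qed

lemma distortion_split:
  assumes A: "finite A"
  shows "distortion \<nu> A = ennreal (1/2) * distortion (distr \<nu> borel T1) A
    + ennreal (1/2) * distortion (distr \<nu> borel T2) A"
proof -
  have "distortion \<nu> A = (\<Sum>i\<in>UNIV.
      ennreal (1/2) * distortion (distr \<nu> borel (if i then T1 else T2)) A)"
    unfolding distortion_def
    using A by (intro nn_integral_finite_mixture)
      (auto simp: self_similar UNIV_bool add.commute finite_measure_axioms
        intro!: finite_measure.finite_measure_distr)
  then show ?thesis
    by (simp add: UNIV_bool add.commute)
qed

text \<open>Taking the images of a quantizer under both \<open>T1\<close> and \<open>T2\<close> at
  most doubles the number of points and divides the bound by 9.\<close>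

lemma ex_quantizer:
  "\<exists>A. finite A \<and> A \<noteq> {} \<and> card A \<le> 2 ^ k \<and> distortion \<nu> A \<le> ennreal ((1/9) ^ k)"
proof (induction k)
  case 0
  have "distortion \<nu> {1/2} \<le> (\<integral>\<^sup>+x. 1 \<partial>\<nu>)"
    unfolding distortion_def
  proof (rule nn_integral_mono_AE)
    show "AE x in \<nu>. ennreal (sq_dist {1/2} x) \<le> 1"
      using AE_hull
    proof eventually_elim
      case (elim x)
      then have "(x - 1/2)\<^sup>2 \<le> 1"
        by (subst abs_square_le_1) auto
      then show ?case
        by (simp add: sq_dist_def)
    qed
  qed
  then show ?case
    using emeasure_space_1 by (intro exI[of _ "{1/2}"]) simp
next
  case (Suc k)
  then obtain A where A: "finite A" "A \<noteq> {}" "card A \<le> 2 ^ k"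
      "distortion \<nu> A \<le> ennreal ((1/9) ^ k)"
    by blast
  let ?B = "T1 ` A \<union> T2 ` A"
  have "card ?B \<le> card A + card A"
    by (rule order_trans[OF card_Un_le add_mono]) (auto intro: card_image_le A)
  then have "card ?B \<le> 2 ^ Suc k"
    using A(3) by simp
  moreover have "distortion \<nu> ?B \<le> ennreal ((1/9) ^ Suc k)"
  proof -
    have "distortion (distr \<nu> borel T1) ?B \<le> ennreal ((1/3)\<^sup>2) * distortion \<nu> A"
         "distortion (distr \<nu> borel T2) ?B \<le> ennreal ((1/3)\<^sup>2) * distortion \<nu> A"
      using A by (intro distortion_distr_affine[OF _ _ _ _ _ T1_def]
          distortion_distr_affine[OF _ _ _ _ _ T2_def]; auto)+
    moreover have "ennreal ((1/3)\<^sup>2) * distortion \<nu> A \<le> ennreal ((1/3)\<^sup>2) * ennreal ((1/9) ^ k)"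
      by (intro mult_left_mono A) simp
    ultimately have le: "distortion (distr \<nu> borel T1) ?B \<le> ennreal ((1/9) ^ Suc k)"
        "distortion (distr \<nu> borel T2) ?B \<le> ennreal ((1/9) ^ Suc k)"
      by (auto simp: ennreal_mult[symmetric] power2_eq_square intro: order_trans)
    have "distortion \<nu> ?B \<le> ennreal (1/2) * ennreal ((1/9) ^ Suc k) + ennreal (1/2) * ennreal ((1/9) ^ Suc k)"
      using A le by (subst distortion_split) (auto intro!: add_mono mult_left_mono)
    also have "\<dots> = ennreal (1/2 * (1/9) ^ Suc k + 1/2 * (1/9) ^ Suc k)"
      by (simp only: ennreal_mult ennreal_plus zero_le_mult_iff zero_le_power
          zero_le_divide_1_iff zero_le_numeral simp_thms)
    finally show ?thesis
      by simp
  qed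
  ultimately show ?case
    using A by (intro exI[of _ ?B]) auto
qed

lemma quantization_ratio_tendsto: "quantization_ratio \<nu> \<longlonglongrightarrow> ln 2 / ln 3"
  unfolding quantization_ratio_def[abs_def]
proof (rule ratio_tendsto_log2_log3)
  show "quantization_error n \<nu> \<le> quantization_error m \<nu>" if "1 \<le> m" "m \<le> n" for m n
    using that by (rule quantization_error_antimono)
  \<comment> \<open>Already 2^k points suffice for \<nu>; the weaker form lets one growth lemma
    serve both measures.\<close>
  show "quantization_error ((k + 1) * 2 ^ k) \<nu> \<le> (1/9) ^ k" for k
  proof -
    obtain A where "finite A" "A \<noteq> {}" "card A \<le> 2 ^ k" "distortion \<nu> A \<le> ennreal ((1/9) ^ k)"
      using ex_quantizer by blast
    then show ?thesis
      by (intro quantization_error_le[of A]) (auto intro: trans_le_add1)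
  qed
  \<comment> \<open>1/1800 is the mass 1/2 times the squared distance factor 1/900 of
    \<open>prob_far_ge\<close>.\<close>
  show "1/1800 * (1/9) ^ k \<le> quantization_error (2 ^ k) \<nu>" for k
    using quantization_error_ge[OF AE_hull, of "1/900 * (1/9) ^ k" "2 ^ k" "1/2"] prob_far_ge[of _ k]
    by simp
qed simp

end

section \<open>The condensation measure\<close>

locale condensation_measure = real_distribution P + nu: self_similar_measure \<nu>
  for P \<nu> :: "real measure" +
  assumes condensation: "\<And>A. A \<in> sets borel \<Longrightarrow>
      measure P A = 1/3 * measure (distr P borel S1) A + 1/3 * measure (distr P borel S2) A
        + 1/3 * measure \<nu> A"
begin

lemma S_measurable [measurable]: "S1 \<in> borel_measurable borel" "S2 \<in> borel_measurable borel"
  unfolding S1_def[abs_def] S2_def[abs_def] by measurable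

lemma prob_split:
  assumes "A \<in> sets borel"
  shows "prob A = 1/3 * prob (S1 -` A) + 1/3 * prob (S2 -` A) + 1/3 * nu.prob A"
  using condensation[OF assms] assms by (simp add: measure_distr_vimage)

text \<open>[0, 1] is spanned by the fixed points of \<open>S1\<close> and \<open>S2\<close>. It
  contains [2/5, 3/5], so \<nu> adds nothing to the tails, and the ratio 1/5 gives the expansion
  factor 5.\<close>

lemma AE_hull: "AE x in P. \<bar>x - 1/2\<bar> \<le> 1/2"
proof (rule AE_le_of_tail_expansion[of 5])
  fix t :: real assume "0 < t"
  let ?A = "{x::real. 1/2 + t < \<bar>x - 1/2\<bar>}" and ?B = "{x::real. 1/2 + 5 * t < \<bar>x - 1/2\<bar>}"
  have "prob (S1 -` ?A) \<le> prob ?B" "prob (S2 -` ?A) \<le> prob ?B"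
    by (intro finite_measure_mono; auto simp: S1_def S2_def abs_if split: if_splits)+
  moreover have "nu.prob ?A = 0"
    using \<open>0 < t\<close> by (intro nu.prob_outside_hull) auto
  moreover have "prob ?A = 1/3 * prob (S1 -` ?A) + 1/3 * prob (S2 -` ?A) + 1/3 * nu.prob ?A"
    by (rule prob_split) simp
  ultimately show "prob ?A \<le> prob ?B"
    using measure_nonneg[of P ?B] by linarith
qed simp

lemma distortion_split:
  assumes A: "finite A"
  shows "distortion P A = ennreal (1/3) * distortion (distr P borel S1) A
    + ennreal (1/3) * distortion (distr P borel S2) A + ennreal (1/3) * distortion \<nu> A"
proof -
  have "distortion P A = (\<Sum>i\<in>{0, 1, 2::nat}. ennreal (1/3) *
      distortion ([distr P borel S1, distr P borel S2, \<nu>] ! i) A)"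
    unfolding distortion_def
    using A by (intro nn_integral_finite_mixture)
      (auto simp: condensation finite_measure_axioms nu.finite_measure_axioms
        intro!: finite_measure.finite_measure_distr)
  then show ?thesis
    by (simp add: add.assoc)
qed

text \<open>The count (k + 1) 2^k solves N(k+1) = 2 N(k) + 2^(k+1) with N(0) = 1: two images of the
  previous quantizer plus a fresh one for \<nu>.\<close>

lemma ex_quantizer:
  "\<exists>A. finite A \<and> A \<noteq> {} \<and> card A \<le> (k + 1) * 2 ^ k \<and> distortion P A \<le> ennreal ((1/9) ^ k)"
proof (induction k)
  case 0
  have "distortion P {1/2} \<le> (\<integral>\<^sup>+x. 1 \<partial>P)"
    unfolding distortion_def
  proof (rule nn_integral_mono_AE)
    show "AE x in P. ennreal (sq_dist {1/2} x) \<le> 1"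
      using AE_hull
    proof eventually_elim
      case (elim x)
      then have "(x - 1/2)\<^sup>2 \<le> 1"
        by (subst abs_square_le_1) auto
      then show ?case
        by (simp add: sq_dist_def)
    qed
  qed
  then show ?case
    using emeasure_space_1 by (intro exI[of _ "{1/2}"]) simp
next
  case (Suc k)
  then obtain A where A: "finite A" "A \<noteq> {}" "card A \<le> (k + 1) * 2 ^ k"
      "distortion P A \<le> ennreal ((1/9) ^ k)"
    by blast
  \<comment> \<open>\<open>C\<close> is taken at level \<open>Suc k\<close>, so that its distortion
    for \<nu> already meets the target; the weight 1/3 leaves room for the two images.\<close>
  obtain C where C: "finite C" "C \<noteq> {}" "card C \<le> 2 ^ Suc k"
      "distortion \<nu> C \<le> ennreal ((1/9) ^ Suc k)"
    using nu.ex_quantizer by blast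
  let ?B = "S1 ` A \<union> S2 ` A \<union> C"
  have "card ?B \<le> card A + card A + card C"
    by (intro order_trans[OF card_Un_le] add_mono card_image_le A order_refl)
  also have "\<dots> \<le> (k + 1) * 2 ^ k + (k + 1) * 2 ^ k + 2 ^ Suc k"
    by (intro add_mono A C)
  finally have "card ?B \<le> (Suc k + 1) * 2 ^ Suc k"
    by (simp add: algebra_simps)
  moreover have "distortion P ?B \<le> ennreal ((1/9) ^ Suc k)"
  proof -
    have "distortion (distr P borel S1) ?B \<le> ennreal ((1/5)\<^sup>2) * distortion P A"
         "distortion (distr P borel S2) ?B \<le> ennreal ((1/5)\<^sup>2) * distortion P A"
      using A C by (intro distortion_distr_affine[of _ _ _ S1 _ 0]
          distortion_distr_affine[OF _ _ _ _ _ S2_def]; auto simp: S1_def)+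
    moreover have "ennreal ((1/5)\<^sup>2) * distortion P A \<le> ennreal ((1/5)\<^sup>2) * ennreal ((1/9) ^ k)"
      by (intro mult_left_mono A) simp
    ultimately have le: "distortion (distr P borel S1) ?B \<le> ennreal (1/25 * (1/9) ^ k)"
        "distortion (distr P borel S2) ?B \<le> ennreal (1/25 * (1/9) ^ k)"
      by (auto simp: ennreal_mult[symmetric] power2_eq_square intro: order_trans)
    have "distortion \<nu> ?B \<le> ennreal ((1/9) ^ Suc k)"
      using A C by (intro order_trans[OF distortion_antimono C(4)]) auto
    then have "distortion P ?B \<le> ennreal (1/3) * ennreal (1/25 * (1/9) ^ k)
        + ennreal (1/3) * ennreal (1/25 * (1/9) ^ k) + ennreal (1/3) * ennreal ((1/9) ^ Suc k)"
      using A C le by (subst distortion_split) (auto intro!: add_mono mult_left_mono)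
    also have "\<dots> = ennreal (1/3 * (1/25 * (1/9) ^ k) + 1/3 * (1/25 * (1/9) ^ k) + 1/3 * (1/9) ^ Suc k)"
      by (simp add: ennreal_mult[symmetric] ennreal_plus[symmetric] del: ennreal_plus)
    also have "\<dots> \<le> ennreal ((1/9) ^ Suc k)"
      by (intro ennreal_leI) simp
    finally show ?thesis .
  qed
  ultimately show ?case
    using A C by (intro exI[of _ ?B]) auto
qed

lemma quantization_ratio_tendsto: "quantization_ratio P \<longlonglongrightarrow> ln 2 / ln 3"
  unfolding quantization_ratio_def[abs_def]
proof (rule ratio_tendsto_log2_log3)
  show "quantization_error n P \<le> quantization_error m P" if "1 \<le> m" "m \<le> n" for m n
    using that by (rule quantization_error_antimono)
  show "quantization_error ((k + 1) * 2 ^ k) P \<le> (1/9) ^ k" for k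
  proof -
    obtain A where "finite A" "A \<noteq> {}" "card A \<le> (k + 1) * 2 ^ k"
        "distortion P A \<le> ennreal ((1/9) ^ k)"
      using ex_quantizer by blast
    then show ?thesis
      by (intro quantization_error_le[of A]) auto
  qed
  \<comment> \<open>Only the \<nu> summand of P is kept: mass 1/3 * 1/2 = 1/6 at squared distance at
    least 9^-k / 900.\<close>
  show "1/5400 * (1/9) ^ k \<le> quantization_error (2 ^ k) P" for k
  proof -
    have "1/6 \<le> prob {x. 1/900 * (1/9) ^ k \<le> sq_dist A x}"
      if A: "finite A" "A \<noteq> {}" "card A \<le> 2 ^ k" for A
    proof -
      have "{x. 1/900 * (1/9) ^ k \<le> sq_dist A x} \<in> sets borel"
        using A by measurable
      then show ?thesis
        using nu.prob_far_ge[OF A] by (subst prob_split) (auto intro: add_increasing)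
    qed
    then show ?thesis
      using quantization_error_ge[OF AE_hull, of "1/900 * (1/9) ^ k" "2 ^ k" "1/6"] by simp
  qed
qed simp

end

section \<open>The exponent \<kappa> and its comparison with ln 2 / ln 3\<close>

text \<open>The base is 1/75, so taking logarithms and clearing 2 + k leaves a linear equation in
  \<open>k\<close>. This gives existence, uniqueness and the closed form together.\<close>

lemma powr_eq_half_iff:
  fixes k :: real
  shows "(1/3 * (1/5)\<^sup>2) powr (k / (2 + k)) = 1/2 \<longleftrightarrow> k = 2 * ln 2 / (ln 75 - ln 2)"
proof -
  have pos: "0 < ln 75 - ln (2::real)"
    by simp
  have "(1/3 * (1/5)\<^sup>2) powr (k / (2 + k)) = (1/2::real)
      \<longleftrightarrow> ln ((1/3 * (1/5)\<^sup>2) powr (k / (2 + k))) = ln (1/2::real)"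
    by (subst ln_inj_iff) auto
  also have "\<dots> \<longleftrightarrow> k / (2 + k) * ln 75 = ln 2"
    by (simp add: ln_powr power2_eq_square ln_div)
  also have "\<dots> \<longleftrightarrow> k * (ln 75 - ln 2) = 2 * ln 2"
  proof (cases "2 + k = 0")
    \<comment> \<open>At k = -2 division by zero makes the exponent 0. Both equations are then
      false, so the convention creates no spurious solution.\<close>
    case True
    then have "k = -2"
      by simp
    then show ?thesis
      by simp
  next
    case False
    then show ?thesis
      by (auto simp: field_simps)
  qed
  also have "\<dots> \<longleftrightarrow> k = 2 * ln 2 / (ln 75 - ln 2)"
    using pos by (simp add: eq_divide_eq)
  finally show ?thesis .
qed

theorem proposition3p4p3:
  fixes P \<nu> :: "real measure" and \<kappa> :: real
  assumes \<nu>_dist: "compactly_supported_distribution \<nu>"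
    and \<nu>_self_similar: "\<And>A. A \<in> sets borel \<Longrightarrow>
      measure \<nu> A = 1/2 * measure (distr \<nu> borel T1) A + 1/2 * measure (distr \<nu> borel T2) A"
    and P_dist: "compactly_supported_distribution P"
    and P_condensation: "\<And>A. A \<in> sets borel \<Longrightarrow>
      measure P A = 1/3 * measure (distr P borel S1) A + 1/3 * measure (distr P borel S2) A
        + 1/3 * measure \<nu> A"
    and \<kappa>: "(1/3 * (1/5)\<^sup>2) powr (\<kappa> / (2 + \<kappa>)) = 1/2"
  shows "(\<exists>!k::real. (1/3 * (1/5)\<^sup>2 :: real) powr (k / (2 + k)) = 1/2)
    \<and> \<kappa> = 2 * ln 2 / (ln 75 - ln 2)
    \<and> quantization_dim_exists \<nu>
    \<and> quantization_dim_exists P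
    \<and> quantization_dim P = max \<kappa> (quantization_dim \<nu>)"
proof -
  interpret nu: self_similar_measure \<nu>
    using \<nu>_dist \<nu>_self_similar
    by (simp add: self_similar_measure_def self_similar_measure_axioms_def
        compactly_supported_distribution_def)
  interpret condensation_measure P \<nu>
    using P_dist P_condensation nu.self_similar_measure_axioms
    by (simp add: condensation_measure_def condensation_measure_axioms_def
        compactly_supported_distribution_def)
  have \<kappa>_eq: "\<kappa> = 2 * ln 2 / (ln 75 - ln 2)"
    using \<kappa> powr_eq_half_iff by simp
  \<comment> \<open>Cleared of denominators this is 2 ln 3 \<le> ln 75 - ln 2, that is, 18 \<le> 75.
    The maximum is therefore attained by the dimension of \<nu>.\<close>
  have "\<kappa> \<le> ln 2 / ln 3"
  proof -
    have "2 * ln (3::real) + ln 2 = ln 18"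
      using ln_mult_pos[of 9 "2::real"] ln_realpow[of 3 2] by simp
    also have "\<dots> \<le> ln (75::real)"
      by simp
    finally have "2 * ln 3 \<le> ln 75 - ln (2::real)"
      by simp
    then have "ln 2 * (2 * ln 3) \<le> ln 2 * (ln 75 - ln (2::real))"
      by (intro mult_left_mono) auto
    then show ?thesis
      unfolding \<kappa>_eq by (simp add: field_simps)
  qed
  moreover have "quantization_dim P = ln 2 / ln 3" "quantization_dim \<nu> = ln 2 / ln 3"
    unfolding quantization_dim_def
    using quantization_ratio_tendsto nu.quantization_ratio_tendsto by (auto intro: limI)
  moreover have "quantization_dim_exists P" "quantization_dim_exists \<nu>"
    unfolding quantization_dim_exists_def
    using quantization_ratio_tendsto nu.quantization_ratio_tendsto by (auto intro: convergentI)
  moreover have "\<exists>!k::real. (1/3 * (1/5)\<^sup>2) powr (k / (2 + k)) = 1/2"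
    unfolding powr_eq_half_iff by simp
  ultimately show ?thesis
    using \<kappa>_eq by simp
qed

end
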